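(* Let $\mathcal{H}$ be a complex Hilbert space, let $A,B\in\mathcal{B}(\mathcal{H})$ and let $S=\begin{bmatrix} 0 & A \\ {B} & 0 \end{bmatrix}\in\mathcal{B}(\mathcal{H}\oplus\mathcal{H})$. Then for every $\lambda\in[0,1]$, $$\|M_\lambda(S)\|\le\max\Big\{\big\|\lambda|A^*|+(1-\lambda)|B|\big\|,\ \big\|\lambda|B^*|+(1-\lambda)|A|\big\|\Big\}.$$
   Context: $\mathcal{B}(\mathcal{H})$ denotes the bounded linear operators on $\mathcal{H}$. For a bounded operator $T$, $|T|=(T^*T)^{1/2}$ and $T=U|T|$ is the canonical polar decomposition ($U$ a partial isometry with $\ker U=\ker T$). The Duggal transform is $T^D=|T|U$, and the $\lambda$-mean transform is $M_\lambda(T)=\lambda T+(1-\lambda)T^D$ for $\lambda\in[0,1]$. *)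

theory Defs
  imports "HOL-Analysis.Analysis"
begin

text \<open>
  Complex Hilbert spaces. The inner product is linear in its first argument. The underlying
  real inner product is its real part, so that the norm of the library is the Hilbert space norm,
  \<open>norm x = sqrt (Re (cinner x x))\<close>, and completeness refers to this norm.
\<close>

class chilbert_space = real_inner + complete_space +
  fixes scaleC :: "complex \<Rightarrow> 'a \<Rightarrow> 'a"  (infixr "*\<^sub>C" 75)
    and cinner :: "'a \<Rightarrow> 'a \<Rightarrow> complex"
  assumes scaleC_add_right: "c *\<^sub>C (x + y) = c *\<^sub>C x + c *\<^sub>C y"
    and scaleC_add_left: "(c + d) *\<^sub>C x = c *\<^sub>C x + d *\<^sub>C x"
    and scaleC_scaleC: "c *\<^sub>C d *\<^sub>C x = (c * d) *\<^sub>C x"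
    and scaleR_scaleC: "r *\<^sub>R x = complex_of_real r *\<^sub>C x"
    and cinner_commute: "cinner x y = cnj (cinner y x)"
    and cinner_add_left: "cinner (x + y) z = cinner x z + cinner y z"
    and cinner_scaleC_left: "cinner (c *\<^sub>C x) y = c * cinner x y"
    and inner_eq_Re_cinner: "inner x y = Re (cinner x y)"

text \<open>The Hilbert space direct sum, on the product type with the norm of the library.\<close>

instantiation prod :: (chilbert_space, chilbert_space) chilbert_space
begin

definition scaleC_prod_def: "c *\<^sub>C p = (c *\<^sub>C fst p, c *\<^sub>C snd p)"

definition cinner_prod_def: "cinner p q = cinner (fst p) (fst q) + cinner (snd p) (snd q)"

instance
proof
  fix c d :: complex and r :: real and x y z :: "'a \<times> 'b"
  show "c *\<^sub>C (x + y) = c *\<^sub>C x + c *\<^sub>C y"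
    by (simp add: scaleC_prod_def scaleC_add_right)
  show "(c + d) *\<^sub>C x = c *\<^sub>C x + d *\<^sub>C x"
    by (simp add: scaleC_prod_def scaleC_add_left)
  show "c *\<^sub>C d *\<^sub>C x = (c * d) *\<^sub>C x"
    by (simp add: scaleC_prod_def scaleC_scaleC)
  show "r *\<^sub>R x = complex_of_real r *\<^sub>C x"
    by (simp add: scaleC_prod_def scaleR_prod_def scaleR_scaleC)
  show "cinner x y = cnj (cinner y x)"
    by (simp add: cinner_prod_def cinner_commute[symmetric])
  show "cinner (x + y) z = cinner x z + cinner y z"
    by (simp add: cinner_prod_def cinner_add_left)
  show "cinner (c *\<^sub>C x) y = c * cinner x y"
    by (simp add: cinner_prod_def scaleC_prod_def cinner_scaleC_left algebra_simps)
  show "inner x y = Re (cinner x y)"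
    by (simp add: cinner_prod_def inner_prod_def inner_eq_Re_cinner)
qed

end

text \<open>
  Elements of the type \<open>'h \<Rightarrow>\<^sub>L 'h\<close> are only real-linear; the bounded operators on a complex
  Hilbert space are the complex-linear ones among them. The operator norm is the same.
\<close>

definition bounded_operators :: "('h::chilbert_space \<Rightarrow>\<^sub>L 'h) set" where
  "bounded_operators = {T. \<forall>c x. blinfun_apply T (c *\<^sub>C x) = c *\<^sub>C blinfun_apply T x}"

definition cadjoint :: "('h::chilbert_space \<Rightarrow>\<^sub>L 'h) \<Rightarrow> ('h \<Rightarrow>\<^sub>L 'h)" where
  "cadjoint T = (THE R. R \<in> bounded_operators \<and>
     (\<forall>x y. cinner (blinfun_apply T x) y = cinner x (blinfun_apply R y)))"

definition positive_operator :: "('h::chilbert_space \<Rightarrow>\<^sub>L 'h) \<Rightarrow> bool" where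
  "positive_operator P \<longleftrightarrow> P \<in> bounded_operators \<and>
     (\<forall>x. cinner (blinfun_apply P x) x \<in> \<real>\<^sub>\<ge>\<^sub>0)"

definition sqrt_operator :: "('h::chilbert_space \<Rightarrow>\<^sub>L 'h) \<Rightarrow> ('h \<Rightarrow>\<^sub>L 'h)" where
  "sqrt_operator Q = (THE P. positive_operator P \<and> P o\<^sub>L P = Q)"

definition abs_operator :: "('h::chilbert_space \<Rightarrow>\<^sub>L 'h) \<Rightarrow> ('h \<Rightarrow>\<^sub>L 'h)" where
  "abs_operator T = sqrt_operator (cadjoint T o\<^sub>L T)"

definition kernel :: "('h::chilbert_space \<Rightarrow>\<^sub>L 'h) \<Rightarrow> 'h set" where
  "kernel T = {x. blinfun_apply T x = 0}"

definition partial_isometry :: "('h::chilbert_space \<Rightarrow>\<^sub>L 'h) \<Rightarrow> bool" where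
  "partial_isometry U \<longleftrightarrow> U \<in> bounded_operators \<and>
     (\<forall>x. (\<forall>y\<in>kernel U. cinner x y = 0) \<longrightarrow> norm (blinfun_apply U x) = norm x)"

definition polar_isometry :: "('h::chilbert_space \<Rightarrow>\<^sub>L 'h) \<Rightarrow> ('h \<Rightarrow>\<^sub>L 'h)" where
  "polar_isometry T =
     (THE U. partial_isometry U \<and> kernel U = kernel T \<and> T = U o\<^sub>L abs_operator T)"

definition duggal_transform :: "('h::chilbert_space \<Rightarrow>\<^sub>L 'h) \<Rightarrow> ('h \<Rightarrow>\<^sub>L 'h)" where
  "duggal_transform T = abs_operator T o\<^sub>L polar_isometry T"

definition mean_transform :: "real \<Rightarrow> ('h::chilbert_space \<Rightarrow>\<^sub>L 'h) \<Rightarrow> ('h \<Rightarrow>\<^sub>L 'h)" where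
  "mean_transform l T = l *\<^sub>R T + (1 - l) *\<^sub>R duggal_transform T"

lift_definition block_operator ::
  "('h::chilbert_space \<Rightarrow>\<^sub>L 'h) \<Rightarrow> ('h \<Rightarrow>\<^sub>L 'h) \<Rightarrow> ('h \<Rightarrow>\<^sub>L 'h) \<Rightarrow> ('h \<Rightarrow>\<^sub>L 'h) \<Rightarrow>
    (('h \<times> 'h) \<Rightarrow>\<^sub>L ('h \<times> 'h))"
  is "\<lambda>T11 T12 T21 T22 (x, y). (T11 x + T12 y, T21 x + T22 y)"
  unfolding case_prod_beta
  by (intro bounded_linear_Pair bounded_linear_add)
     (auto intro: bounded_linear_compose bounded_linear_fst bounded_linear_snd)

end

theory Submission
  imports Defs
begin

text \<open>
  Let \<open>T = U |T|\<close> be the polar decomposition. Then also \<open>T = |T*| U\<close>, whereas \<open>T\<^sup>D = |T| U\<close>, so that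
  \<open>M\<^sub>\<lambda>(T) = (\<lambda> |T*| + (1 - \<lambda>) |T|) U\<close> with \<open>norm U \<le> 1\<close>. For \<open>T = S\<close> the operators \<open>|S|\<close> and \<open>|S*|\<close>
  are the block diagonal operators with entries \<open>|B|, |A|\<close> and \<open>|A*|, |B*|\<close>, and the norm of a block
  diagonal operator is the maximum of the norms of its entries.

  Most arguments use the real inner product only: an operator that commutes with multiplication
  by \<open>\<i>\<close> is complex-linear, and its adjoints for \<open>inner\<close> and for \<open>cinner\<close> coincide.
\<close>

text \<open>With this instance \<open>'h \<Rightarrow>\<^sub>L 'h\<close> is a Banach space, so that
  norm-summable series of operators converge.\<close>

instance chilbert_space \<subseteq> banach ..

section \<open>Orthogonal projections and the Riesz representation\<close>

lemma subspace_closure: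
  fixes M :: "'a::real_normed_vector set"
  assumes "subspace M"
  shows "subspace (closure M)"
  unfolding subspace_def
proof (intro conjI ballI allI)
  show "0 \<in> closure M"
    using subspace_0[OF assms] closure_subset by blast
next
  fix x y
  assume "x \<in> closure M" "y \<in> closure M"
  then obtain a b where a: "\<And>n. a n \<in> M" "a \<longlonglongrightarrow> x" and b: "\<And>n. b n \<in> M" "b \<longlonglongrightarrow> y"
    unfolding closure_sequential by blast
  have "(\<lambda>n. a n + b n) \<longlonglongrightarrow> x + y"
    using a(2) b(2) by (rule tendsto_add)
  then show "x + y \<in> closure M"
    unfolding closure_sequential using subspace_add[OF assms a(1) b(1)]
    by (intro exI[of _ "\<lambda>n. a n + b n"]) simp
next
  fix c :: real and x
  assume "x \<in> closure M"
  then obtain a where a: "\<And>n. a n \<in> M" "a \<longlonglongrightarrow> x"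
    unfolding closure_sequential by blast
  have "(\<lambda>n. c *\<^sub>R a n) \<longlonglongrightarrow> c *\<^sub>R x"
    using tendsto_const a(2) by (rule tendsto_scaleR)
  then show "c *\<^sub>R x \<in> closure M"
    unfolding closure_sequential using subspace_scale[OF assms a(1)]
    by (intro exI[of _ "\<lambda>n. c *\<^sub>R a n"]) simp
qed

text \<open>A minimizing sequence for the distance from \<open>x\<close> to \<open>M\<close> is
  Cauchy, and its limit is a closest point. Since \<open>M\<close> is a subspace, the variational
  inequality at that point turns into orthogonality.\<close>

lemma exists_orthogonal_projection:
  fixes M :: "'a::{real_inner, complete_space} set"
  assumes "subspace M" and "closed M"
  shows "\<exists>m\<in>M. \<forall>y\<in>M. inner (x - m) y = 0"
proof -
  define D where "D = (INF y\<in>M. (norm (x - y))\<^sup>2)"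
  have ne: "M \<noteq> {}"
    using \<open>subspace M\<close> by (auto simp: subspace_def)
  have bdd: "bdd_below ((\<lambda>y. (norm (x - y))\<^sup>2) ` M)"
    by (rule bdd_belowI[of _ 0]) auto
  have D_le: "D \<le> (norm (x - y))\<^sup>2" if "y \<in> M" for y
    unfolding D_def using bdd that by (rule cINF_lower)
  have "\<exists>y\<in>M. (norm (x - y))\<^sup>2 < D + inverse (real (Suc n))" for n
  proof -
    have "(INF y\<in>M. (norm (x - y))\<^sup>2) < D + inverse (real (Suc n))"
      unfolding D_def[symmetric] by simp
    then show ?thesis
      using cINF_less_iff[OF ne bdd] by blast
  qed
  then obtain m where mM: "\<And>n. m n \<in> M"
    and m_less: "\<And>n. (norm (x - m n))\<^sup>2 < D + inverse (real (Suc n))"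
    by metis
  have dist_m: "(dist (m i) (m j))\<^sup>2 \<le> 2 * inverse (real (Suc i)) + 2 * inverse (real (Suc j))" for i j
  proof -
    \<comment> \<open>The midpoint lies in \<open>M\<close>, so its squared distance to
      \<open>x\<close> is at least \<open>D\<close>; the parallelogram law then bounds the distance
      between \<open>m i\<close> and \<open>m j\<close>.\<close>
    have "(1/2) *\<^sub>R (m i + m j) \<in> M"
      using \<open>subspace M\<close> mM by (simp add: subspace_add subspace_scale)
    from D_le[OF this] have "D \<le> (norm (x - (1/2) *\<^sub>R (m i + m j)))\<^sup>2" .
    moreover have "(dist (m i) (m j))\<^sup>2 = 2 * (norm (x - m i))\<^sup>2 + 2 * (norm (x - m j))\<^sup>2
        - 4 * (norm (x - (1/2) *\<^sub>R (m i + m j)))\<^sup>2"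
      by (simp add: dist_norm power2_norm_eq_inner inner_diff_left inner_diff_right
          inner_add_left inner_add_right inner_commute algebra_simps)
    ultimately show ?thesis
      using m_less[of i] m_less[of j] by linarith
  qed
  have "Cauchy m"
  proof (rule metric_CauchyI)
    fix e :: real
    assume "0 < e"
    then have "0 < e\<^sup>2 / 4" by simp
    then obtain N where N: "inverse (real (Suc N)) < e\<^sup>2 / 4"
      using reals_Archimedean by blast
    have "dist (m i) (m j) < e" if "i \<ge> N" "j \<ge> N" for i j
    proof (rule power2_less_imp_less)
      have "inverse (real (Suc i)) \<le> inverse (real (Suc N))"
        and "inverse (real (Suc j)) \<le> inverse (real (Suc N))"
        using that by (simp_all add: field_simps)
      then show "(dist (m i) (m j))\<^sup>2 < e\<^sup>2"
        using dist_m[of i j] N by linarith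
    qed (use \<open>0 < e\<close> in simp)
    then show "\<exists>N. \<forall>i\<ge>N. \<forall>j\<ge>N. dist (m i) (m j) < e"
      by blast
  qed
  then obtain p where p: "m \<longlonglongrightarrow> p"
    using Cauchy_convergent_iff convergent_def by blast
  have pM: "p \<in> M"
    using \<open>closed M\<close> mM p by (rule closed_sequentially)
  have "(\<lambda>n. (norm (x - m n))\<^sup>2) \<longlonglongrightarrow> (norm (x - p))\<^sup>2"
    by (intro tendsto_intros p)
  moreover have "(\<lambda>n. D + inverse (real (Suc n))) \<longlonglongrightarrow> D + 0"
    by (intro tendsto_intros LIMSEQ_inverse_real_of_nat)
  ultimately have p_le: "(norm (x - p))\<^sup>2 \<le> D + 0"
    by (rule LIMSEQ_le) (use m_less less_imp_le in blast)
  have closest: "dist x p \<le> dist x y" if "y \<in> M" for y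
  proof -
    have "(norm (x - p))\<^sup>2 \<le> (norm (x - y))\<^sup>2"
      using p_le D_le[OF that] by linarith
    then show ?thesis
      unfolding dist_norm by (rule power2_le_imp_le) simp
  qed
  have le: "inner (x - p) y \<le> 0" if "y \<in> M" for y
  proof -
    \<comment> \<open>The closest-point inequality for convex sets is tested at
      \<open>p + y\<close>.\<close>
    have "p + y \<in> M"
      using \<open>subspace M\<close> pM that by (rule subspace_add)
    then have "inner (x - p) (p + y - p) \<le> 0"
      using any_closest_point_dot[OF subspace_imp_convex \<open>closed M\<close> pM] \<open>subspace M\<close> closest
      by blast
    then show ?thesis by simp
  qed
  \<comment> \<open>The inequality applies to \<open>- y\<close> as well, which forces
    equality.\<close>
  have "inner (x - p) y = 0" if "y \<in> M" for y
    using le[OF that] le[of "- y"] subspace_neg[OF \<open>subspace M\<close> that] by simp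
  then show ?thesis
    using pM by blast
qed

text \<open>The kernel of a nonzero functional is a closed hyperplane. A vector normal to it, scaled
  so that both sides agree at that vector, represents \<open>f\<close>.\<close>

lemma Riesz_representation:
  fixes f :: "'a::{real_inner, complete_space} \<Rightarrow> real"
  assumes "bounded_linear f"
  shows "\<exists>z. \<forall>x. f x = inner x z"
proof (cases "\<forall>x. f x = 0")
  case True
  then show ?thesis by (intro exI[of _ 0]) simp
next
  case False
  then obtain u where u: "f u \<noteq> 0" by blast
  interpret f: bounded_linear f by fact
  have "closed {x. f x = 0}"
    by (intro closed_Collect_eq continuous_intros f.continuous_on)
  moreover have "subspace {x. f x = 0}"
    by (simp add: subspace_def f.add f.scaleR f.zero)
  ultimately obtain m where m: "f m = 0" "\<And>y. f y = 0 \<Longrightarrow> inner (u - m) y = 0"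
    using exists_orthogonal_projection[of "{x. f x = 0}" u] by auto
  define w where "w = u - m"
  have fw: "f w \<noteq> 0"
    using u m(1) by (simp add: w_def f.diff)
  then have "w \<noteq> 0" using f.zero by auto
  have "f x = inner x ((f w / inner w w) *\<^sub>R w)" for x
  proof -
    \<comment> \<open>Splits \<open>x\<close> into a multiple of \<open>w\<close> and a vector of
      the kernel, which is orthogonal to \<open>w\<close>.\<close>
    have "f (x - (f x / f w) *\<^sub>R w) = 0"
      using fw by (simp add: f.diff f.scaleR)
    then have "inner w (x - (f x / f w) *\<^sub>R w) = 0"
      unfolding w_def by (rule m(2))
    then show ?thesis
      using fw \<open>w \<noteq> 0\<close> by (simp add: inner_diff_right inner_commute field_simps)
  qed
  then show ?thesis by blast
qed

lemma exists_real_adjoint: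
  fixes T :: "'a::{real_inner, complete_space} \<Rightarrow>\<^sub>L 'b::real_inner"
  shows "\<exists>R :: 'b \<Rightarrow>\<^sub>L 'a. \<forall>x y. inner (T x) y = inner x (R y)"
proof -
  have "\<exists>z. \<forall>x. inner (T x) y = inner x z" for y
    by (rule Riesz_representation)
      (intro bounded_linear_intros)
  then obtain R where R: "\<And>x y. inner (T x) y = inner x (R y)"
    by metis
  have "bounded_linear R"
  proof (rule bounded_linear_intro[where K = "norm T"])
    fix y z :: 'b and r :: real
    show "R (y + z) = R y + R z"
      by (rule vector_eq_ldot[THEN iffD1]) (simp add: R[symmetric] inner_add_right)
    show "R (r *\<^sub>R y) = r *\<^sub>R R y"
      by (rule vector_eq_ldot[THEN iffD1]) (simp add: R[symmetric])
    \<comment> \<open>Testing the adjoint identity at \<open>R y\<close> bounds \<open>R\<close> by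
      \<open>norm T\<close>, once a factor \<open>norm (R y)\<close> is cancelled.\<close>
    have "norm (R y) * norm (R y) = inner (T (R y)) y"
      by (simp add: R flip: power2_norm_eq_inner power2_eq_square)
    also have "\<dots> \<le> norm (T (R y)) * norm y"
      by (rule norm_cauchy_schwarz)
    also have "\<dots> \<le> (norm T * norm (R y)) * norm y"
      by (intro mult_right_mono norm_blinfun) simp
    finally have "norm (R y) * norm (R y) \<le> (norm y * norm T) * norm (R y)"
      by (simp add: algebra_simps)
    then show "norm (R y) \<le> norm y * norm T"
      by (cases "R y = 0") (auto simp: mult_le_cancel_right)
  qed
  then show ?thesis
    using R by (intro exI[of _ "Blinfun R"]) (simp add: bounded_linear_Blinfun_apply)
qed

section \<open>Complex-linear operators and their adjoints\<close>

text \<open>Since \<open>Im z = - Re (\<i> * z)\<close>, the complex inner product can be recovered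
  from the real one and multiplication by \<open>\<i>\<close>.\<close>

lemma cinner_conv_inner: "cinner x y = Complex (inner x y) (- inner (\<i> *\<^sub>C x) y)"
  for x y :: "'h::chilbert_space"
  by (rule complex_eqI) (simp_all add: inner_eq_Re_cinner cinner_scaleC_left)

lemma inner_scaleC_ii: "inner (\<i> *\<^sub>C x) y = - inner x (\<i> *\<^sub>C y)" for x y :: "'h::chilbert_space"
proof -
  have "inner (\<i> *\<^sub>C x) y = Re (\<i> * cinner x y)"
    by (simp add: inner_eq_Re_cinner cinner_scaleC_left)
  also have "\<dots> = - Re (cnj (\<i> * cinner y x))"
    using cinner_commute[of x y] by simp
  also have "\<dots> = - inner (\<i> *\<^sub>C y) x"
    by (simp add: inner_eq_Re_cinner cinner_scaleC_left)
  finally show ?thesis by (simp add: inner_commute)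
qed

lemma scaleC_conv_scaleR: "c *\<^sub>C x = Re c *\<^sub>R x + Im c *\<^sub>R (\<i> *\<^sub>C x)" for x :: "'h::chilbert_space"
proof -
  have "c = complex_of_real (Re c) + complex_of_real (Im c) * \<i>"
    by (simp add: complex_eq_iff)
  then have "c *\<^sub>C x = (complex_of_real (Re c) + complex_of_real (Im c) * \<i>) *\<^sub>C x"
    by simp
  also have "\<dots> = Re c *\<^sub>R x + Im c *\<^sub>R (\<i> *\<^sub>C x)"
    by (simp add: scaleC_add_left scaleR_scaleC scaleC_scaleC)
  finally show ?thesis .
qed

lemma scaleC_ii_ii [simp]: "\<i> *\<^sub>C \<i> *\<^sub>C x = - x" for x :: "'h::chilbert_space"
  using scaleR_scaleC[of "-1" x] by (simp add: scaleC_scaleC)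

lemma bounded_linear_scaleC_ii: "bounded_linear (\<lambda>x :: 'h::chilbert_space. \<i> *\<^sub>C x)"
proof (rule bounded_linear_intro[where K = 1])
  fix x y :: 'h and r :: real
  show "\<i> *\<^sub>C (x + y) = \<i> *\<^sub>C x + \<i> *\<^sub>C y"
    by (rule scaleC_add_right)
  show "\<i> *\<^sub>C r *\<^sub>R x = r *\<^sub>R \<i> *\<^sub>C x"
    by (simp add: scaleR_scaleC scaleC_scaleC mult.commute)
  have "inner (\<i> *\<^sub>C x) (\<i> *\<^sub>C x) = inner x x"
    by (simp add: inner_scaleC_ii)
  then show "norm (\<i> *\<^sub>C x) \<le> norm x * 1"
    by (simp add: norm_eq_sqrt_inner)
qed

text \<open>Real scalars pass through every element of \<open>'h \<Rightarrow>\<^sub>L 'h\<close>,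
  and a complex scalar is \<open>Re c + Im c * \<i>\<close>, so only multiplication by
  \<open>\<i>\<close> has to be tested.\<close>

lemma bounded_operators_iff:
  "T \<in> bounded_operators \<longleftrightarrow> (\<forall>x. T (\<i> *\<^sub>C x) = \<i> *\<^sub>C T x)"
proof
  show "T \<in> bounded_operators" if "\<forall>x. T (\<i> *\<^sub>C x) = \<i> *\<^sub>C T x"
    unfolding bounded_operators_def
    using that by (subst (1 2) scaleC_conv_scaleR) (simp add: blinfun.bilinear_simps)
qed (simp add: bounded_operators_def)

lemma bounded_operators_apply_ii: "T \<in> bounded_operators \<Longrightarrow> T (\<i> *\<^sub>C x) = \<i> *\<^sub>C T x"
  by (simp add: bounded_operators_def)

lemma bounded_operators_compose:
  "S \<in> bounded_operators \<Longrightarrow> T \<in> bounded_operators \<Longrightarrow> S o\<^sub>L T \<in> bounded_operators"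
  by (simp add: bounded_operators_def)

lemma bounded_operators_add:
  "S \<in> bounded_operators \<Longrightarrow> T \<in> bounded_operators \<Longrightarrow> S + T \<in> bounded_operators"
  by (simp add: bounded_operators_def blinfun.add_left scaleC_add_right)

lemma bounded_operators_scaleR: "T \<in> bounded_operators \<Longrightarrow> r *\<^sub>R T \<in> bounded_operators"
  by (simp add: bounded_operators_def blinfun.scaleR_left scaleR_scaleC scaleC_scaleC mult.commute)

lemma bounded_operators_diff:
  "S \<in> bounded_operators \<Longrightarrow> T \<in> bounded_operators \<Longrightarrow> S - T \<in> bounded_operators"
  using bounded_operators_add[of S "(-1) *\<^sub>R T"] bounded_operators_scaleR[of T "-1"] by simp

lemma bounded_operators_id: "id_blinfun \<in> bounded_operators"
  by (simp add: bounded_operators_def)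

lemma bounded_operators_zero: "0 \<in> bounded_operators"
  using bounded_operators_scaleR[OF bounded_operators_id, of 0] by simp

text \<open>Norm convergence gives pointwise convergence, and multiplication by \<open>\<i>\<close>
  is continuous. This serves the limit in the construction of square roots.\<close>

lemma bounded_operators_limit:
  assumes "X \<longlonglongrightarrow> T" and "\<And>n. X n \<in> bounded_operators"
  shows "T \<in> bounded_operators"
  unfolding bounded_operators_iff
proof
  fix x
  have "(\<lambda>n. X n (\<i> *\<^sub>C x)) \<longlonglongrightarrow> T (\<i> *\<^sub>C x)"
    by (intro tendsto_intros assms(1))
  moreover have "(\<lambda>n. \<i> *\<^sub>C X n x) \<longlonglongrightarrow> \<i> *\<^sub>C T x"
    by (intro bounded_linear.tendsto[OF bounded_linear_scaleC_ii] tendsto_intros assms(1))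
  ultimately show "T (\<i> *\<^sub>C x) = \<i> *\<^sub>C T x"
    using LIMSEQ_unique assms(2) by (simp add: bounded_operators_apply_ii)
qed

text \<open>Multiplication by \<open>\<i>\<close> is skew-adjoint for \<open>inner\<close>. Moving
  it to the side of \<open>T\<close>, through \<open>T\<close> and back costs two signs, which
  cancel.\<close>

lemma bounded_operators_adjoint:
  fixes T R :: "'h::chilbert_space \<Rightarrow>\<^sub>L 'h"
  assumes "T \<in> bounded_operators" and adj: "\<And>x y. inner (T x) y = inner x (R y)"
  shows "R \<in> bounded_operators"
  unfolding bounded_operators_iff
proof
  fix y
  show "R (\<i> *\<^sub>C y) = \<i> *\<^sub>C R y"
  proof (rule vector_eq_ldot[THEN iffD1], rule allI)
    fix x
    have "inner x (R (\<i> *\<^sub>C y)) = - inner (\<i> *\<^sub>C T x) y"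
      by (simp add: adj[symmetric] inner_scaleC_ii)
    also have "\<dots> = inner x (\<i> *\<^sub>C R y)"
      using assms(1) by (simp add: bounded_operators_apply_ii[symmetric] adj inner_scaleC_ii)
    finally show "inner x (R (\<i> *\<^sub>C y)) = inner x (\<i> *\<^sub>C R y)" .
  qed
qed

text \<open>Evaluates the definite description: complex linearity lifts the identity from
  \<open>inner\<close> to \<open>cinner\<close>, and uniqueness holds because \<open>inner\<close>
  separates points.\<close>

lemma cadjoint_eqI:
  fixes T R :: "'h::chilbert_space \<Rightarrow>\<^sub>L 'h"
  assumes "T \<in> bounded_operators" and adj: "\<And>x y. inner (T x) y = inner x (R y)"
  shows "cadjoint T = R"
  unfolding cadjoint_def
proof (rule the_equality)
  show "R \<in> bounded_operators \<and> (\<forall>x y. cinner (T x) y = cinner x (R y))"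
    using bounded_operators_adjoint[OF assms] assms
    by (simp add: cinner_conv_inner bounded_operators_apply_ii flip: adj)
next
  fix R'
  assume "R' \<in> bounded_operators \<and> (\<forall>x y. cinner (T x) y = cinner x (R' y))"
  then have "inner x (R' y) = inner (T x) y" for x y
    by (simp add: inner_eq_Re_cinner)
  then show "R' = R"
    by (intro blinfun_eqI vector_eq_ldot[THEN iffD1]) (simp add: adj)
qed

lemma inner_cadjoint:
  assumes "T \<in> bounded_operators"
  shows "inner (T x) y = inner x (cadjoint T y)"
  using exists_real_adjoint[of T] cadjoint_eqI[OF assms] by blast

lemma bounded_operators_cadjoint: "T \<in> bounded_operators \<Longrightarrow> cadjoint T \<in> bounded_operators"
  using bounded_operators_adjoint inner_cadjoint by blast

lemma cadjoint_cadjoint: "T \<in> bounded_operators \<Longrightarrow> cadjoint (cadjoint T) = T"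
  by (rule cadjoint_eqI)
    (simp add: bounded_operators_cadjoint, metis inner_cadjoint inner_commute)

section \<open>Positive operators and their square roots\<close>

text \<open>A real-valued complex quadratic form has vanishing imaginary part, and polarizing that
  part yields symmetry of \<open>P\<close>. Conversely, symmetry and complex linearity make the
  imaginary part equal to its own negative.\<close>

lemma positive_operator_iff:
  "positive_operator P \<longleftrightarrow> P \<in> bounded_operators \<and>
     (\<forall>x y. inner (P x) y = inner x (P y)) \<and> (\<forall>x. 0 \<le> inner (P x) x)"
  (is "_ \<longleftrightarrow> ?R")
proof
  assume "positive_operator P"
  then have P: "P \<in> bounded_operators" and pos: "\<And>x. 0 \<le> inner (P x) x"
    and im: "\<And>x. inner (\<i> *\<^sub>C P x) x = 0"
    by (simp_all add: positive_operator_def cinner_conv_inner complex_nonneg_Reals_iff)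
  have polar: "inner (\<i> *\<^sub>C P x) y = - inner (\<i> *\<^sub>C P y) x" for x y
    using im[of "x + y"] im[of x] im[of y]
    by (simp add: blinfun.add_right scaleC_add_right inner_add_left inner_add_right)
  \<comment> \<open>Replacing \<open>x\<close> by \<open>\<i> *\<^sub>C x\<close> turns the
    antisymmetry of the imaginary part into the symmetry of the real part.\<close>
  have "inner (P x) y = inner x (P y)" for x y
    using polar[of "\<i> *\<^sub>C x" y] P
    by (simp add: bounded_operators_apply_ii inner_scaleC_ii[of "P y"] inner_commute[of "P y"])
  then show ?R using P pos by blast
next
  assume R: ?R
  have "inner (\<i> *\<^sub>C P x) x = - inner (\<i> *\<^sub>C P x) x" for x
  proof -
    have "inner (\<i> *\<^sub>C P x) x = - inner x (\<i> *\<^sub>C P x)"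
      using R by (metis bounded_operators_apply_ii inner_scaleC_ii)
    then show ?thesis by (simp add: inner_commute)
  qed
  then show "positive_operator P"
    using R by (simp add: positive_operator_def cinner_conv_inner complex_nonneg_Reals_iff
        inner_commute)
qed

lemma positive_operatorI:
  assumes "P \<in> bounded_operators" and "\<And>x y. inner (P x) y = inner x (P y)"
    and "\<And>x. 0 \<le> inner (P x) x"
  shows "positive_operator P"
  using assms positive_operator_iff by blast

lemma positive_operator_selfadjoint: "positive_operator P \<Longrightarrow> inner (P x) y = inner x (P y)"
  by (simp add: positive_operator_iff)

lemma positive_operator_bounded: "positive_operator P \<Longrightarrow> P \<in> bounded_operators"
  by (simp add: positive_operator_iff)

lemma positive_operator_inner_nonneg: "positive_operator P \<Longrightarrow> 0 \<le> inner (P x) x"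
  by (metis positive_operator_iff)

lemma positive_operator_scaleR: "positive_operator P \<Longrightarrow> 0 \<le> r \<Longrightarrow> positive_operator (r *\<^sub>R P)"
  unfolding positive_operator_iff
  by (auto simp only: bounded_operators_scaleR blinfun.scaleR_left inner_scaleR_left
      inner_scaleR_right intro: mult_nonneg_nonneg)

text \<open>The form \<open>inner (P x) y\<close> is symmetric and positive semidefinite, so its
  restriction to the span of \<open>x\<close> and \<open>y\<close> is a nonnegative quadratic in
  \<open>s\<close> and \<open>t\<close>.\<close>

lemma positive_operator_Cauchy_Schwarz:
  assumes "positive_operator P"
  shows "(inner (P x) y)\<^sup>2 \<le> inner (P x) x * inner (P y) y"
proof -
  define a b c where "a = inner (P x) x" and "b = inner (P x) y" and "c = inner (P y) y"
  have quad: "0 \<le> s\<^sup>2 * a + 2 * s * t * b + t\<^sup>2 * c" for s t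
  proof -
    have "inner (P y) x = b"
      using assms by (metis b_def positive_operator_selfadjoint inner_commute)
    then have "inner (P (s *\<^sub>R x + t *\<^sub>R y)) (s *\<^sub>R x + t *\<^sub>R y) = s\<^sup>2 * a + 2 * s * t * b + t\<^sup>2 * c"
      by (simp add: a_def b_def c_def blinfun.bilinear_simps inner_add_left inner_add_right
          power2_eq_square algebra_simps)
    then show ?thesis
      using positive_operator_inner_nonneg[OF assms] by metis
  qed
  have "0 \<le> a" "0 \<le> c"
    using assms by (simp_all add: a_def c_def positive_operator_inner_nonneg)
  show ?thesis
    unfolding a_def[symmetric] b_def[symmetric] c_def[symmetric]
  proof (cases "a = 0")
    case True
    have "b = 0"
    proof (rule ccontr)
      assume "b \<noteq> 0"
      \<comment> \<open>With \<open>a = 0\<close> and \<open>t = 1\<close> the quadratic is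
        \<open>2 * s * b + c\<close>; this choice of \<open>s\<close> gives it the negative value
        \<open>- c - 2\<close>.\<close>
      then have "- (c + 1) / b * b = - (c + 1)" by simp
      then have "2 * (- (c + 1) / b) * 1 * b = - 2 * (c + 1)"
        by (metis mult.assoc mult.commute mult.right_neutral mult_minus_right mult_minus_left)
      then show False
        using quad[of "- (c + 1) / b" 1] True \<open>0 \<le> c\<close> by simp
    qed
    then show "b\<^sup>2 \<le> a * c" using True by simp
  next
    case False
    then have "0 < a" using \<open>0 \<le> a\<close> by simp
    \<comment> \<open>The choice \<open>s = b\<close>, \<open>t = - a\<close> makes the quadratic
      equal to \<open>a\<close> times the discriminant term.\<close>
    moreover have "0 \<le> a * (a * c - b\<^sup>2)"
      using quad[of b "- a"] by (simp add: power2_eq_square algebra_simps)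
    ultimately show "b\<^sup>2 \<le> a * c"
      by (simp add: zero_le_mult_iff)
  qed
qed

text \<open>Cauchy-Schwarz for the form of \<open>P\<close>, with \<open>P x\<close> as second
  vector, bounds the fourth power of \<open>norm (P x)\<close> by \<open>0\<close>.\<close>

lemma positive_operator_inner_eq_0:
  assumes "positive_operator P" and "inner (P x) x = 0"
  shows "P x = 0"
  using positive_operator_Cauchy_Schwarz[OF assms(1), of x "P x"] assms(2) by simp

text \<open>Cauchy-Schwarz for the form of \<open>P\<close> at \<open>x\<close> and
  \<open>P x\<close> gives the fourth power of \<open>norm (P x)\<close> on the left; the hypothesis
  at both vectors bounds the right side, and the square of \<open>norm (P x)\<close>
  cancels.\<close>

lemma positive_operator_norm_le_1:
  assumes "positive_operator P" and le: "\<And>x. inner (P x) x \<le> (norm x)\<^sup>2"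
  shows "norm P \<le> 1"
proof (rule norm_blinfun_bound)
  fix x
  have "((norm (P x))\<^sup>2)\<^sup>2 \<le> inner (P x) x * inner (P (P x)) (P x)"
    using positive_operator_Cauchy_Schwarz[OF assms(1), of x "P x"]
    by (simp add: power2_norm_eq_inner)
  also have "\<dots> \<le> (norm x)\<^sup>2 * (norm (P x))\<^sup>2"
    using assms by (intro mult_mono le positive_operator_inner_nonneg) auto
  finally have "(norm (P x))\<^sup>2 * (norm (P x))\<^sup>2 \<le> (norm x)\<^sup>2 * (norm (P x))\<^sup>2"
    by (simp add: power2_eq_square)
  then have "(norm (P x))\<^sup>2 \<le> (norm x)\<^sup>2"
    by (cases "P x = 0") (simp_all only: mult_le_cancel_right, simp_all)
  then have "norm (P x) \<le> norm x"
    by (rule power2_le_imp_le) simp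
  then show "norm (P x) \<le> 1 * norm x" by simp
qed simp

lemma compose_commute2:
  assumes "T o\<^sub>L X = X o\<^sub>L T" and "T o\<^sub>L Z = Z o\<^sub>L T"
  shows "T o\<^sub>L (X o\<^sub>L Z) = (X o\<^sub>L Z) o\<^sub>L T"
proof (rule blinfun_eqI)
  fix x
  show "(T o\<^sub>L (X o\<^sub>L Z)) x = ((X o\<^sub>L Z) o\<^sub>L T) x"
    using arg_cong[OF assms(1), of "\<lambda>V. V (Z x)"] arg_cong[OF assms(2), of "\<lambda>V. V x"] by simp
qed

lemma commute_limit:
  assumes "X \<longlonglongrightarrow> L" and "\<And>n. T o\<^sub>L X n = X n o\<^sub>L T"
  shows "T o\<^sub>L L = L o\<^sub>L T"
proof -
  have "(\<lambda>n. T o\<^sub>L X n) \<longlonglongrightarrow> (T o\<^sub>L L)" and "(\<lambda>n. X n o\<^sub>L T) \<longlonglongrightarrow> (L o\<^sub>L T)"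
    by (intro bounded_bilinear.tendsto[OF bounded_bilinear_blinfun_compose] tendsto_const assms(1))+
  then show ?thesis
    using assms(2) LIMSEQ_unique by simp
qed

text \<open>
  With \<open>R = 1 - Q\<close> the square root is \<open>1 - Y\<close>, where \<open>Y = (R + Y\<^sup>2) / 2\<close> is found by iteration from
  \<open>0\<close>. The increments are dominated by those of the scalar iteration for \<open>R = 1\<close>, which is
  increasing and bounded by \<open>1\<close>; hence convergence is in norm even when \<open>norm R = 1\<close>.
\<close>

lemma exists_sqrt_operator_contraction:
  fixes Q :: "'h::chilbert_space \<Rightarrow>\<^sub>L 'h"
  assumes Q: "positive_operator Q" and Q1: "norm Q \<le> 1"
  shows "\<exists>P. positive_operator P \<and> P o\<^sub>L P = Q \<and> (\<forall>T. T o\<^sub>L Q = Q o\<^sub>L T \<longrightarrow> T o\<^sub>L P = P o\<^sub>L T)"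
proof -
  interpret comp: bounded_bilinear "(o\<^sub>L) :: ('h \<Rightarrow>\<^sub>L 'h) \<Rightarrow> ('h \<Rightarrow>\<^sub>L 'h) \<Rightarrow> _"
    by (rule bounded_bilinear_blinfun_compose)
  define R where "R = id_blinfun - Q"
  have R_sa: "inner (R x) y = inner x (R y)" for x y
    using Q by (simp add: R_def blinfun.diff_left inner_diff_left inner_diff_right
        positive_operator_selfadjoint)
  have R_bo: "R \<in> bounded_operators"
    using Q by (simp add: R_def bounded_operators_diff bounded_operators_id positive_operator_bounded)
  have "positive_operator R"
  proof -
    have "inner (Q x) x \<le> norm x * norm x" for x
    proof -
      have "inner (Q x) x \<le> norm (Q x) * norm x"
        by (rule norm_cauchy_schwarz)
      also have "\<dots> \<le> (norm Q * norm x) * norm x"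
        by (intro mult_right_mono norm_blinfun) simp
      also have "\<dots> \<le> norm x * norm x"
        using Q1 by (intro mult_right_mono mult_left_le_one_le) auto
      finally show ?thesis .
    qed
    then have "0 \<le> inner (R x) x" for x
      by (simp add: R_def blinfun.diff_left inner_diff_left norm_eq_sqrt_inner)
    then show ?thesis
      using R_sa R_bo by (intro positive_operatorI)
  qed
  \<comment> \<open>Positivity of \<open>Q\<close> says that the form of \<open>R\<close> is at most
    the square of the norm.\<close>
  then have R1: "norm R \<le> 1"
    by (rule positive_operator_norm_le_1)
      (use Q in \<open>simp add: R_def blinfun.diff_left inner_diff_left power2_norm_eq_inner
        positive_operator_inner_nonneg\<close>)
  define Y where "Y = rec_nat (0 :: 'h \<Rightarrow>\<^sub>L 'h) (\<lambda>_ Z. (1/2) *\<^sub>R (R + (Z o\<^sub>L Z)))"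
  define y where "y = rec_nat (0 :: real) (\<lambda>_ z. (1 + z * z) / 2)"
  have Y_0: "Y 0 = 0" and Y_Suc: "Y (Suc n) = (1/2) *\<^sub>R (R + (Y n o\<^sub>L Y n))" for n
    by (simp_all add: Y_def)
  have y_0: "y 0 = 0" and y_Suc: "y (Suc n) = (1 + y n * y n) / 2" for n
    by (simp_all add: y_def)
  have y01: "0 \<le> y n \<and> y n \<le> 1" for n
  proof (induction n)
    case (Suc n)
    then have "y n * y n \<le> 1 * 1" by (intro mult_mono) auto
    then show ?case by (simp add: y_Suc)
  qed (simp add: y_0)
  have Y_le: "norm (Y n) \<le> y n" for n
  proof (induction n)
    case (Suc n)
    have "norm (Y n o\<^sub>L Y n) \<le> y n * y n"
      by (rule order_trans[OF norm_blinfun_compose], rule mult_mono) (use Suc y01[of n] in auto)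
    then have "norm (R + (Y n o\<^sub>L Y n)) \<le> 1 + y n * y n"
      using R1 by (intro order_trans[OF norm_triangle_ineq] add_mono)
    then show ?case by (simp add: Y_Suc y_Suc)
  qed (simp add: Y_0 y_0)
  have step: "norm (Y (Suc n) - Y n) \<le> y (Suc n) - y n" for n
  proof (induction n)
    case 0
    then show ?case using R1 by (simp add: Y_0 y_0 Y_Suc y_Suc)
  next
    case (Suc n)
    define Z W where "Z = Y (Suc n)" and "W = Y n"
    define z w where "z = y (Suc n)" and "w = y n"
    have bounds: "norm Z \<le> z" "norm W \<le> w" "norm (Z - W) \<le> z - w"
      using Suc Y_le by (simp_all add: Z_def W_def z_def w_def)
    have "Y (Suc (Suc n)) - Y (Suc n) = (1/2) *\<^sub>R (R + (Z o\<^sub>L Z)) - (1/2) *\<^sub>R (R + (W o\<^sub>L W))"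
      by (simp only: Z_def W_def Y_Suc)
    \<comment> \<open>This splitting of the difference of squares holds without commutativity, and
      it has the same shape as the scalar one.\<close>
    also have "\<dots> = (1/2) *\<^sub>R ((Z o\<^sub>L (Z - W)) + ((Z - W) o\<^sub>L W))"
      by (rule blinfun_eqI) (simp add: blinfun.bilinear_simps algebra_simps)
    also have "norm \<dots> \<le> (1/2) * (z * (z - w) + (z - w) * w)"
    proof -
      have "norm (Z o\<^sub>L (Z - W)) \<le> z * (z - w)"
        by (rule order_trans[OF norm_blinfun_compose], rule mult_mono)
          (use bounds y01[of "Suc n"] in \<open>auto simp: z_def\<close>)
      moreover have "norm ((Z - W) o\<^sub>L W) \<le> (z - w) * w"
        by (rule order_trans[OF norm_blinfun_compose], rule mult_mono)
          (use bounds order_trans[OF norm_ge_zero bounds(3)] in auto)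
      ultimately have "norm ((Z o\<^sub>L (Z - W)) + ((Z - W) o\<^sub>L W)) \<le> z * (z - w) + (z - w) * w"
        by (intro order_trans[OF norm_triangle_ineq] add_mono)
      then show ?thesis by simp
    qed
    also have "\<dots> = (1 + z * z) / 2 - (1 + w * w) / 2"
      by (simp add: algebra_simps)
    also have "\<dots> = y (Suc (Suc n)) - y (Suc n)"
      by (simp only: z_def w_def y_Suc)
    finally show ?case .
  qed
  \<comment> \<open>Each scalar increment dominates a norm, hence is nonnegative.\<close>
  have "incseq y"
    by (rule incseq_SucI) (use order_trans[OF norm_ge_zero step] in simp)
  then obtain c where "y \<longlonglongrightarrow> c"
    using incseq_convergent[of y 1] y01 by blast
  then have "summable (\<lambda>n. y (Suc n) - y n)"
    by (rule telescope_summable)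
  then have "summable (\<lambda>n. Y (Suc n) - Y n)"
    by (rule summable_comparison_test'[where N = 0]) (rule step)
  then have "convergent Y"
    by (simp add: summable_iff_convergent sum_lessThan_telescope Y_0)
  then obtain L where L: "Y \<longlonglongrightarrow> L"
    by (auto simp: convergent_def)
  have "(\<lambda>n. Y (Suc n)) \<longlonglongrightarrow> (1/2) *\<^sub>R (R + (L o\<^sub>L L))"
    unfolding Y_Suc by (intro tendsto_intros comp.tendsto L)
  moreover have "(\<lambda>n. Y (Suc n)) \<longlonglongrightarrow> L"
    using L by (rule LIMSEQ_Suc)
  ultimately have "(1/2) *\<^sub>R (R + (L o\<^sub>L L)) = L"
    by (rule LIMSEQ_unique)
  then have "2 *\<^sub>R ((1/2) *\<^sub>R (R + (L o\<^sub>L L))) = 2 *\<^sub>R L"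
    by (rule arg_cong)
  \<comment> \<open>The fixed-point equation without the factor \<open>1/2\<close>; it says that the
    square of \<open>id_blinfun - L\<close> is \<open>id_blinfun - R\<close>, which is
    \<open>Q\<close>.\<close>
  then have fix_L: "R + (L o\<^sub>L L) = L + L"
    by (simp add: scaleR_2)
  have L1: "norm L \<le> 1"
    by (rule LIMSEQ_le_const2[OF tendsto_norm[OF L]]) (use order_trans[OF Y_le] y01 in blast)
  have "Y n \<in> bounded_operators" for n
    by (induction n) (simp_all add: Y_0 Y_Suc R_bo bounded_operators_zero bounded_operators_scaleR
        bounded_operators_add bounded_operators_compose)
  then have L_bo: "L \<in> bounded_operators"
    by (rule bounded_operators_limit[OF L])
  have Y_sa: "inner (Y n x) z = inner x (Y n z)" for n x z
    by (induction n arbitrary: x z) 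
      (simp_all add: Y_0 Y_Suc R_sa blinfun.bilinear_simps inner_add_left inner_add_right)
  have L_sa: "inner (L x) z = inner x (L z)" for x z
  proof -
    have "(\<lambda>n. inner (Y n x) z) \<longlonglongrightarrow> inner (L x) z" and "(\<lambda>n. inner x (Y n z)) \<longlonglongrightarrow> inner x (L z)"
      by (intro tendsto_intros L)+
    then show ?thesis
      using LIMSEQ_unique Y_sa by simp
  qed
  \<comment> \<open>Every iterate is a polynomial in \<open>Q\<close>, and commutation passes to
    norm limits.\<close>
  have L_comm: "T o\<^sub>L L = L o\<^sub>L T" if "T o\<^sub>L Q = Q o\<^sub>L T" for T
  proof (rule commute_limit[OF L])
    have id: "T o\<^sub>L id_blinfun = T" "id_blinfun o\<^sub>L T = T"
      by (auto intro: blinfun_eqI)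
    show "T o\<^sub>L Y n = Y n o\<^sub>L T" for n
    proof (induction n)
      case (Suc n)
      have "T o\<^sub>L (Y n o\<^sub>L Y n) = (Y n o\<^sub>L Y n) o\<^sub>L T"
        using compose_commute2[OF Suc Suc] .
      then show ?case
        using that by (simp add: Y_Suc R_def id comp.add_left comp.add_right comp.diff_left comp.diff_right
            comp.scaleR_left comp.scaleR_right)
    qed (simp add: Y_0)
  qed
  define P where "P = id_blinfun - L"
  have "positive_operator P"
  proof -
    have "inner (L x) x \<le> inner x x" for x
    proof -
      have "inner (L x) x \<le> norm (L x) * norm x"
        by (rule norm_cauchy_schwarz)
      also have "\<dots> \<le> (norm L * norm x) * norm x"
        by (intro mult_right_mono norm_blinfun) simp
      also have "\<dots> \<le> norm x * norm x"
        using L1 by (intro mult_right_mono mult_left_le_one_le) auto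
      finally show ?thesis by (simp add: norm_eq_sqrt_inner)
    qed
    then have "0 \<le> inner (P x) x" for x
      by (simp add: P_def blinfun.diff_left inner_diff_left)
    then show ?thesis
      by (intro positive_operatorI) (simp_all add: P_def L_bo L_sa blinfun.diff_left
          inner_diff_left inner_diff_right bounded_operators_diff bounded_operators_id)
  qed
  moreover have "P o\<^sub>L P = Q"
  proof (rule blinfun_eqI)
    fix x
    have "R x + L (L x) = L x + L x"
      using arg_cong[OF fix_L, of "\<lambda>Z. Z x"] by (simp add: blinfun.add_left)
    then show "(P o\<^sub>L P) x = Q x"
      by (simp add: P_def R_def blinfun.bilinear_simps algebra_simps)
  qed
  moreover have "T o\<^sub>L P = P o\<^sub>L T" if "T o\<^sub>L Q = Q o\<^sub>L T" for T
  proof (rule blinfun_eqI)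
    fix x
    show "(T o\<^sub>L P) x = (P o\<^sub>L T) x"
      using arg_cong[OF L_comm[OF that], of "\<lambda>Z. Z x"] by (simp add: P_def blinfun.bilinear_simps)
  qed
  ultimately show ?thesis by blast
qed

text \<open>Rescaling reduces this to contractions. The commutation clause is what the uniqueness of
  the square root rests on.\<close>

lemma exists_commuting_sqrt_operator:
  fixes Q :: "'h::chilbert_space \<Rightarrow>\<^sub>L 'h"
  assumes "positive_operator Q"
  obtains P where "positive_operator P" "P o\<^sub>L P = Q"
    "\<And>T. T o\<^sub>L Q = Q o\<^sub>L T \<Longrightarrow> T o\<^sub>L P = P o\<^sub>L T"
proof -
  interpret comp: bounded_bilinear "(o\<^sub>L) :: ('h \<Rightarrow>\<^sub>L 'h) \<Rightarrow> ('h \<Rightarrow>\<^sub>L 'h) \<Rightarrow> _"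
    by (rule bounded_bilinear_blinfun_compose)
  \<comment> \<open>The summand \<open>1\<close> keeps \<open>c\<close> positive when
    \<open>Q = 0\<close>.\<close>
  define c where "c = norm Q + 1"
  have "0 < c" by (simp add: c_def add_nonneg_pos)
  have "positive_operator (inverse c *\<^sub>R Q)"
    using assms \<open>0 < c\<close> by (simp add: positive_operator_scaleR)
  moreover have "norm (inverse c *\<^sub>R Q) \<le> 1"
    using \<open>0 < c\<close> by (simp add: c_def field_simps)
  ultimately obtain P where P: "positive_operator P" "P o\<^sub>L P = inverse c *\<^sub>R Q"
    and comm: "\<And>T. T o\<^sub>L (inverse c *\<^sub>R Q) = (inverse c *\<^sub>R Q) o\<^sub>L T \<Longrightarrow> T o\<^sub>L P = P o\<^sub>L T"
    using exists_sqrt_operator_contraction by blast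
  show ?thesis
  proof (rule that)
    show "positive_operator (sqrt c *\<^sub>R P)"
      using P \<open>0 < c\<close> by (simp add: positive_operator_scaleR)
    show "(sqrt c *\<^sub>R P) o\<^sub>L (sqrt c *\<^sub>R P) = Q"
      using P \<open>0 < c\<close> by (simp add: comp.scaleR_left comp.scaleR_right flip: mult.assoc)
    show "T o\<^sub>L (sqrt c *\<^sub>R P) = (sqrt c *\<^sub>R P) o\<^sub>L T" if "T o\<^sub>L Q = Q o\<^sub>L T" for T
      using comm[of T] that by (simp add: comp.scaleR_left comp.scaleR_right)
  qed
qed

text \<open>For commuting roots \<open>P + P'\<close> annihilates every
  \<open>w = P x - P' x\<close>. Two nonnegative forms with sum \<open>0\<close> at \<open>w\<close>
  both vanish there, so \<open>P w = P' w = 0\<close>, and self-adjointness gives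
  \<open>inner w w = 0\<close>.\<close>

lemma sqrt_operator_unique:
  fixes P P' :: "'h::chilbert_space \<Rightarrow>\<^sub>L 'h"
  assumes P: "positive_operator P" and P': "positive_operator P'"
    and eq: "P o\<^sub>L P = P' o\<^sub>L P'" and comm: "P o\<^sub>L P' = P' o\<^sub>L P"
  shows "P = P'"
proof (rule blinfun_eqI)
  fix x
  have sq: "P (P z) = P' (P' z)" and cm: "P (P' z) = P' (P z)" for z
    using arg_cong[OF eq, of "\<lambda>Z. Z z"] arg_cong[OF comm, of "\<lambda>Z. Z z"] by simp_all
  define w where "w = P x - P' x"
  have "P w + P' w = 0"
    by (simp add: w_def blinfun.diff_right sq cm)
  then have "inner (P w) w + inner (P' w) w = 0"
    by (metis inner_add_left inner_zero_left)
  then have "inner (P w) w = 0" "inner (P' w) w = 0"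
    using positive_operator_inner_nonneg[OF P, of w] positive_operator_inner_nonneg[OF P', of w]
    by linarith+
  then have "P w = 0" "P' w = 0"
    using P P' positive_operator_inner_eq_0 by blast+
  then have "inner w w = 0"
    using positive_operator_selfadjoint[OF P, of x w] positive_operator_selfadjoint[OF P', of x w]
    unfolding w_def by (simp add: inner_diff_left)
  then show "P x = P' x" by (simp add: w_def)
qed

text \<open>Any positive root commutes with its square \<open>Q\<close>, hence with the constructed
  root \<open>P0\<close>, which commutes with everything that commutes with \<open>Q\<close>. So
  uniqueness among commuting roots is enough.\<close>

lemma sqrt_operator_eqI:
  assumes P: "positive_operator P" and PQ: "P o\<^sub>L P = Q"
  shows "sqrt_operator Q = P"
proof -
  have Qx: "Q x = P (P x)" for x
    using PQ by auto
  have "positive_operator Q"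
  proof (rule positive_operatorI)
    show "Q \<in> bounded_operators"
      using P PQ by (metis bounded_operators_compose positive_operator_bounded)
    show "inner (Q x) y = inner x (Q y)" for x y
      by (simp add: Qx positive_operator_selfadjoint[OF P])
    show "0 \<le> inner (Q x) x" for x
      unfolding Qx positive_operator_selfadjoint[OF P, of "P x"] by simp
  qed
  then obtain P0 where P0: "positive_operator P0" "P0 o\<^sub>L P0 = Q"
    and comm: "\<And>T. T o\<^sub>L Q = Q o\<^sub>L T \<Longrightarrow> T o\<^sub>L P0 = P0 o\<^sub>L T"
    by (blast elim: exists_commuting_sqrt_operator)
  have eq: "P' = P0" if "positive_operator P'" "P' o\<^sub>L P' = Q" for P'
  proof -
    have "P' o\<^sub>L Q = Q o\<^sub>L P'"
      using compose_commute2[OF refl refl, of P'] that(2) by simp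
    then have "P' o\<^sub>L P0 = P0 o\<^sub>L P'"
      by (rule comm)
    then show ?thesis
      using sqrt_operator_unique[OF that(1) P0(1)] that(2) P0(2) by metis
  qed
  show ?thesis
    unfolding sqrt_operator_def
    by (rule the_equality) (use assms eq in auto)
qed

section \<open>The absolute value of an operator\<close>

lemma positive_operator_cadjoint_compose:
  assumes "T \<in> bounded_operators"
  shows "positive_operator (cadjoint T o\<^sub>L T)"
proof (rule positive_operatorI)
  fix x y
  have eq: "inner (cadjoint T (T x)) y = inner (T x) (T y)" for x y
    using inner_cadjoint[OF assms, of y "T x"] by (simp add: inner_commute)
  show "inner ((cadjoint T o\<^sub>L T) x) y = inner x ((cadjoint T o\<^sub>L T) y)"
    using eq[of x y] eq[of y x] by (simp add: inner_commute)
  show "0 \<le> inner ((cadjoint T o\<^sub>L T) x) x"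
    by (simp add: eq)
qed (simp add: assms bounded_operators_compose bounded_operators_cadjoint)

lemma
  assumes "T \<in> bounded_operators"
  shows positive_abs_operator: "positive_operator (abs_operator T)"
    and abs_operator_square: "abs_operator T o\<^sub>L abs_operator T = cadjoint T o\<^sub>L T"
proof -
  obtain P where "positive_operator P" "P o\<^sub>L P = cadjoint T o\<^sub>L T"
    using exists_commuting_sqrt_operator positive_operator_cadjoint_compose[OF assms] by blast
  moreover from this have "abs_operator T = P"
    unfolding abs_operator_def by (rule sqrt_operator_eqI)
  ultimately show "positive_operator (abs_operator T)"
    "abs_operator T o\<^sub>L abs_operator T = cadjoint T o\<^sub>L T"
    by simp_all
qed

lemma abs_operator_eqI:
  "positive_operator P \<Longrightarrow> P o\<^sub>L P = cadjoint T o\<^sub>L T \<Longrightarrow> abs_operator T = P"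
  unfolding abs_operator_def by (rule sqrt_operator_eqI)

text \<open>Both sides are the form of \<open>cadjoint T o\<^sub>L T\<close>. Hence
  \<open>|T| y \<mapsto> T y\<close> is well defined and isometric, the starting point of the polar
  decomposition.\<close>

lemma inner_abs_operator:
  assumes "T \<in> bounded_operators"
  shows "inner (abs_operator T x) (abs_operator T y) = inner (T x) (T y)"
proof -
  have "inner (abs_operator T x) (abs_operator T y) = inner x ((abs_operator T o\<^sub>L abs_operator T) y)"
    using positive_abs_operator[OF assms] by (simp add: positive_operator_selfadjoint)
  also have "\<dots> = inner (T x) (T y)"
    using assms by (simp add: abs_operator_square inner_cadjoint)
  finally show ?thesis .
qed

lemma norm_abs_operator: "T \<in> bounded_operators \<Longrightarrow> norm (abs_operator T x) = norm (T x)"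
  by (simp add: norm_eq_sqrt_inner inner_abs_operator)

section \<open>The polar decomposition\<close>

text \<open>
  The closure \<open>C\<close> of the graph of \<open>|T| y \<mapsto> T y\<close> is the graph of an isometry on the closure of the
  range of \<open>|T|\<close>; extended by \<open>0\<close> on the orthogonal complement, it is the graph \<open>G\<close> of \<open>U\<close>.
\<close>

lemma exists_polar_isometry:
  fixes T :: "'h::chilbert_space \<Rightarrow>\<^sub>L 'h"
  assumes T: "T \<in> bounded_operators"
  shows "\<exists>U. partial_isometry U \<and> kernel U = kernel T \<and> T = U o\<^sub>L abs_operator T \<and> norm U \<le> 1"
proof -
  define P where "P = abs_operator T"
  have P_bo: "P \<in> bounded_operators" and P_sa: "inner (P x) y = inner x (P y)" for x y
    using positive_abs_operator[OF T]
    by (simp_all add: P_def positive_operator_bounded positive_operator_selfadjoint)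
  have norm_P: "norm (P x) = norm (T x)" for x
    using T by (simp add: P_def norm_abs_operator)
  have P_eq_0: "P x = 0 \<longleftrightarrow> T x = 0" for x
    using norm_P[of x] by auto
  \<comment> \<open>\<open>P\<close> is self-adjoint, so the orthogonal complement of its range lies
    in its kernel.\<close>
  have P_orth: "P z = 0" if "\<And>y. inner z (P y) = 0" for z
    using that[of "P z"] P_sa[of z "P z"] by simp
  define C where "C = closure (range (\<lambda>y. (P y, T y)))"
  have C_seq: "p \<in> C \<longleftrightarrow> (\<exists>y. (\<lambda>n. P (y n)) \<longlonglongrightarrow> fst p \<and> (\<lambda>n. T (y n)) \<longlonglongrightarrow> snd p)" for p
  proof
    assume "p \<in> C"
    then obtain q where q: "\<And>n. q n \<in> range (\<lambda>y. (P y, T y))" "q \<longlonglongrightarrow> p"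
      unfolding C_def closure_sequential by blast
    then have "\<forall>n. \<exists>y. q n = (P y, T y)" by blast
    then obtain y where "\<And>n. q n = (P (y n), T (y n))" by metis
    then show "\<exists>y. (\<lambda>n. P (y n)) \<longlonglongrightarrow> fst p \<and> (\<lambda>n. T (y n)) \<longlonglongrightarrow> snd p"
      using tendsto_fst[OF q(2)] tendsto_snd[OF q(2)] by auto
  next
    assume "\<exists>y. (\<lambda>n. P (y n)) \<longlonglongrightarrow> fst p \<and> (\<lambda>n. T (y n)) \<longlonglongrightarrow> snd p"
    then obtain y where "(\<lambda>n. (P (y n), T (y n))) \<longlonglongrightarrow> (fst p, snd p)"
      using tendsto_Pair by blast
    then show "p \<in> C"
      unfolding C_def closure_sequential by (intro exI[of _ "\<lambda>n. (P (y n), T (y n))"]) simp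
  qed
  have C_range: "(P y, T y) \<in> C" for y
    unfolding C_def by (rule subsetD[OF closure_subset], rule rangeI)
  have C_add: "(m + m', v + v') \<in> C" if pq: "(m, v) \<in> C" "(m', v') \<in> C" for m v m' v'
  proof -
    obtain y y' where "(\<lambda>n. P (y n)) \<longlonglongrightarrow> m" "(\<lambda>n. T (y n)) \<longlonglongrightarrow> v"
      "(\<lambda>n. P (y' n)) \<longlonglongrightarrow> m'" "(\<lambda>n. T (y' n)) \<longlonglongrightarrow> v'"
      using pq unfolding C_seq by auto
    then have "(\<lambda>n. P (y n + y' n)) \<longlonglongrightarrow> m + m'" "(\<lambda>n. T (y n + y' n)) \<longlonglongrightarrow> v + v'"
      by (simp_all add: blinfun.add_right tendsto_add)
    then show ?thesis
      unfolding C_seq by (intro exI[of _ "\<lambda>n. y n + y' n"]) simp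
  qed
  have C_scaleR: "(r *\<^sub>R m, r *\<^sub>R v) \<in> C" if p: "(m, v) \<in> C" for r m v
  proof -
    obtain y where "(\<lambda>n. P (y n)) \<longlonglongrightarrow> m" "(\<lambda>n. T (y n)) \<longlonglongrightarrow> v"
      using p unfolding C_seq by auto
    then have "(\<lambda>n. P (r *\<^sub>R y n)) \<longlonglongrightarrow> r *\<^sub>R m" "(\<lambda>n. T (r *\<^sub>R y n)) \<longlonglongrightarrow> r *\<^sub>R v"
      by (simp_all add: blinfun.scaleR_right tendsto_scaleR)
    then show ?thesis
      unfolding C_seq by (intro exI[of _ "\<lambda>n. r *\<^sub>R y n"]) simp
  qed
  have C_ii: "(\<i> *\<^sub>C m, \<i> *\<^sub>C v) \<in> C" if p: "(m, v) \<in> C" for m v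
  proof -
    obtain y where "(\<lambda>n. P (y n)) \<longlonglongrightarrow> m" "(\<lambda>n. T (y n)) \<longlonglongrightarrow> v"
      using p unfolding C_seq by auto
    then have "(\<lambda>n. P (\<i> *\<^sub>C y n)) \<longlonglongrightarrow> \<i> *\<^sub>C m" "(\<lambda>n. T (\<i> *\<^sub>C y n)) \<longlonglongrightarrow> \<i> *\<^sub>C v"
      using T P_bo bounded_linear.tendsto[OF bounded_linear_scaleC_ii]
      by (simp_all add: bounded_operators_apply_ii)
    then show ?thesis
      unfolding C_seq by (intro exI[of _ "\<lambda>n. \<i> *\<^sub>C y n"]) simp
  qed
  have C_norm: "norm v = norm m" if p: "(m, v) \<in> C" for m v
  proof -
    obtain y where y: "(\<lambda>n. P (y n)) \<longlonglongrightarrow> m" "(\<lambda>n. T (y n)) \<longlonglongrightarrow> v"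
      using p unfolding C_seq by auto
    then have "(\<lambda>n. norm (T (y n))) \<longlonglongrightarrow> norm m"
      using tendsto_norm[OF y(1)] by (simp add: norm_P)
    then show ?thesis
      using LIMSEQ_unique tendsto_norm[OF y(2)] by blast
  qed
  have C_orth: "inner z m = 0" if p: "(m, v) \<in> C" and z: "\<And>y. inner z (P y) = 0" for z m v
  proof -
    obtain y where y: "(\<lambda>n. P (y n)) \<longlonglongrightarrow> m"
      using p unfolding C_seq by auto
    have "(\<lambda>n. inner z (P (y n))) \<longlonglongrightarrow> inner z m"
      by (intro tendsto_intros y)
    then show ?thesis
      using z by (simp add: LIMSEQ_const_iff)
  qed
  \<comment> \<open>Here \<open>m\<close> is the orthogonal projection of \<open>x\<close> to the
    closure of \<open>range P\<close>. Orthogonality is demanded on \<open>range P\<close> only;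
    \<open>C_orth\<close> extends it to first components of \<open>C\<close>.\<close>
  define G where "G x v \<longleftrightarrow> (\<exists>m. (m, v) \<in> C \<and> (\<forall>y. inner (x - m) (P y) = 0))" for x v
  have G_E: thesis
    if "G x v" and m: "\<And>m. (m, v) \<in> C \<Longrightarrow> (\<And>y. inner (x - m) (P y) = 0) \<Longrightarrow> thesis" for x v thesis
  proof -
    obtain m where mC: "(m, v) \<in> C" and 0: "\<forall>y. inner (x - m) (P y) = 0"
      using \<open>G x v\<close> unfolding G_def by blast
    show thesis by (rule m[OF mC]) (rule spec[OF 0])
  qed
  have G_total: "\<exists>v. G x v" for x
  proof -
    have "subspace (range P)"
      by (intro real_vector.linear_subspace_image subspace_UNIV
          bounded_linear.linear blinfun.bounded_linear_right)
    then have "subspace (closure (range P))"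
      by (rule subspace_closure)
    then obtain m where m: "m \<in> closure (range P)" "\<And>y. y \<in> closure (range P) \<Longrightarrow> inner (x - m) y = 0"
      using exists_orthogonal_projection[of "closure (range P)" x] by auto
    obtain q where q: "\<And>n. q n \<in> range P" "q \<longlonglongrightarrow> m"
      using m(1) unfolding closure_sequential by blast
    then have "\<forall>n. \<exists>y. q n = P y" by blast
    then obtain y where y: "\<And>n. q n = P (y n)" by metis
    \<comment> \<open>\<open>T\<close> and \<open>P\<close> have equal norms at every vector, so
      \<open>T (y n)\<close> is Cauchy whenever \<open>P (y n)\<close> is.\<close>
    have dist_T: "dist (T a) (T b) = dist (P a) (P b)" for a b
      by (simp add: dist_norm norm_P flip: blinfun.diff_right)
    have "Cauchy (\<lambda>n. P (y n))"
      using LIMSEQ_imp_Cauchy[OF q(2)] by (simp add: y[symmetric])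
    then have "Cauchy (\<lambda>n. T (y n))"
      unfolding Cauchy_def dist_T .
    then obtain v where "(\<lambda>n. T (y n)) \<longlonglongrightarrow> v"
      using Cauchy_convergent_iff convergent_def by blast
    then have "(m, v) \<in> C"
      unfolding C_seq using q(2) y by (intro exI[of _ y]) (simp add: y[symmetric])
    moreover have "inner (x - m) (P y) = 0" for y
      by (rule m(2), rule subsetD[OF closure_subset], rule rangeI)
    ultimately show ?thesis
      unfolding G_def by blast
  qed
  have G_add: "G (x + x') (v + v')" if g: "G x v" and g': "G x' v'" for x v x' v'
  proof -
    obtain m where m: "(m, v) \<in> C" "\<And>y. inner (x - m) (P y) = 0"
      using G_E[OF g] by blast
    obtain m' where m': "(m', v') \<in> C" "\<And>y. inner (x' - m') (P y) = 0"
      using G_E[OF g'] by blast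
    from m(1) m'(1) have "(m + m', v + v') \<in> C" by (intro C_add)
    moreover have "inner (x + x' - (m + m')) (P y) = 0" for y
      using m(2)[of y] m'(2)[of y] by (simp add: inner_diff_left inner_add_left)
    ultimately show ?thesis unfolding G_def by blast
  qed
  have G_scaleR: "G (r *\<^sub>R x) (r *\<^sub>R v)" if g: "G x v" for r x v
  proof -
    obtain m where "(m, v) \<in> C" and 0: "\<And>y. inner (x - m) (P y) = 0"
      using G_E[OF g] by blast
    then have "(r *\<^sub>R m, r *\<^sub>R v) \<in> C" by (intro C_scaleR)
    moreover have "inner (r *\<^sub>R x - r *\<^sub>R m) (P y) = 0" for y
      using 0[of y] by (simp flip: scaleR_diff_right)
    ultimately show ?thesis unfolding G_def by blast
  qed
  have G_ii: "G (\<i> *\<^sub>C x) (\<i> *\<^sub>C v)" if g: "G x v" for x v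
  proof -
    obtain m where "(m, v) \<in> C" and 0: "\<And>y. inner (x - m) (P y) = 0"
      using G_E[OF g] by blast
    then have "(\<i> *\<^sub>C m, \<i> *\<^sub>C v) \<in> C" by (intro C_ii)
    moreover have "inner (\<i> *\<^sub>C x - \<i> *\<^sub>C m) (P y) = 0" for y
      using 0[of "\<i> *\<^sub>C y"] P_bo
      by (simp add: inner_diff_left inner_scaleC_ii bounded_operators_apply_ii)
    ultimately show ?thesis unfolding G_def by blast
  qed
  have G_norm: "norm v \<le> norm x" if g: "G x v" for x v
  proof -
    obtain m where m: "(m, v) \<in> C" "\<And>y. inner (x - m) (P y) = 0"
      using G_E[OF g] by blast
    then have "inner (x - m) m = 0" by (rule C_orth)
    then have "norm m * norm m = inner x m"
      by (simp add: inner_diff_left flip: power2_norm_eq_inner power2_eq_square)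
    also have "\<dots> \<le> norm x * norm m"
      by (rule norm_cauchy_schwarz)
    finally have "norm m \<le> norm x"
      by (cases "m = 0") (simp_all only: mult_le_cancel_right, simp_all)
    then show ?thesis
      using C_norm[OF m(1)] by simp
  qed
  \<comment> \<open>The difference of two values at \<open>x\<close> is a value at \<open>0\<close>,
    and the norm bound makes it \<open>0\<close>.\<close>
  have G_unique: "v = v'" if "G x v" "G x v'" for x v v'
    using G_norm[OF G_add[OF that(1) G_scaleR[OF that(2), of "-1"]]] by simp
  obtain u where u: "\<And>x. G x (u x)"
    using G_total by metis
  have "bounded_linear u"
  proof (rule bounded_linear_intro[where K = 1])
    show "u (x + y) = u x + u y" for x y
      using G_unique[OF u G_add[OF u u]] .
    show "u (r *\<^sub>R x) = r *\<^sub>R u x" for r x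
      using G_unique[OF u G_scaleR[OF u]] .
    show "norm (u x) \<le> norm x * 1" for x
      using G_norm[OF u] by simp
  qed
  define U where "U = Blinfun u"
  have G_U: "G x (U x)" for x
    using u \<open>bounded_linear u\<close> by (simp add: U_def bounded_linear_Blinfun_apply)
  have U_bo: "U \<in> bounded_operators"
    unfolding bounded_operators_iff using G_unique[OF G_U G_ii[OF G_U]] by blast
  have ker: "U x = 0 \<longleftrightarrow> T x = 0" for x
  proof
    assume "U x = 0"
    then obtain m where m: "(m, 0) \<in> C" "\<And>y. inner (x - m) (P y) = 0"
      using G_U[of x] by (auto elim: G_E)
    then have "m = 0" using C_norm[of m 0] by simp
    then have "P x = 0" using m(2) by (intro P_orth) simp
    then show "T x = 0" by (simp add: P_eq_0)
  next
    assume "T x = 0"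
    then have "P x = 0" by (simp add: P_eq_0)
    then have "inner (x - 0) (P y) = 0" for y
      using P_sa[of x y] by simp
    moreover have "(0, 0) \<in> C" using C_range[of 0] by simp
    ultimately have "G x 0" unfolding G_def by blast
    then show "U x = 0" by (rule G_unique[OF G_U])
  qed
  have "partial_isometry U"
    unfolding partial_isometry_def
  proof (intro conjI allI impI U_bo)
    fix x
    assume x: "\<forall>y\<in>kernel U. cinner x y = 0"
    obtain m where m: "(m, U x) \<in> C" "\<And>y. inner (x - m) (P y) = 0"
      using G_E[OF G_U] by blast
    \<comment> \<open>The component \<open>x - m\<close> lies in the kernel of \<open>U\<close> and
      is thus orthogonal to \<open>x\<close>; being orthogonal to \<open>m\<close> too, it is
      \<open>0\<close>.\<close>
    then have "P (x - m) = 0" by (intro P_orth)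
    then have "x - m \<in> kernel U" by (simp add: kernel_def ker P_eq_0)
    then have "inner x (x - m) = 0" using x by (simp add: inner_eq_Re_cinner)
    moreover have "inner (x - m) m = 0" using m by (rule C_orth)
    ultimately have "inner (x - m) (x - m) = 0"
      by (simp add: inner_diff_right inner_commute)
    then have "x = m" by simp
    then show "norm (U x) = norm x" using C_norm[OF m(1)] by simp
  qed
  moreover have "kernel U = kernel T"
    by (simp add: kernel_def ker)
  moreover have "T = U o\<^sub>L abs_operator T"
  proof (rule blinfun_eqI)
    fix y
    have "G (P y) (T y)" unfolding G_def using C_range[of y] by (intro exI[of _ "P y"]) simp
    then show "T y = (U o\<^sub>L abs_operator T) y"
      using G_unique[OF _ G_U] by (simp add: P_def)
  qed
  moreover have "norm U \<le> 1"
    by (rule norm_blinfun_bound) (use G_norm[OF G_U] in auto)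
  ultimately show ?thesis by blast
qed

text \<open>\<open>D = U - V\<close> vanishes on the range of \<open>|T|\<close>, so the range of
  \<open>cadjoint D\<close> lies in the kernel of \<open>|T|\<close>, which is the common kernel of
  \<open>T\<close>, \<open>U\<close> and \<open>V\<close>. Thus
  \<open>D o\<^sub>L cadjoint D\<close> is \<open>0\<close>, and so is \<open>D\<close>.\<close>

lemma polar_isometry_unique:
  fixes T :: "'h::chilbert_space \<Rightarrow>\<^sub>L 'h"
  assumes T: "T \<in> bounded_operators"
    and U: "U \<in> bounded_operators" "kernel U = kernel T" "T = U o\<^sub>L abs_operator T"
    and V: "V \<in> bounded_operators" "kernel V = kernel T" "T = V o\<^sub>L abs_operator T"
  shows "U = V"
proof -
  define D where "D = U - V"
  have D: "D \<in> bounded_operators"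
    using U V by (simp add: D_def bounded_operators_diff)
  have "U (abs_operator T x) = V (abs_operator T x)" for x
    using arg_cong[OF U(3), of "\<lambda>Z. Z x"] arg_cong[OF V(3), of "\<lambda>Z. Z x"] by simp
  then have D_abs: "D (abs_operator T x) = 0" for x
    by (simp add: D_def blinfun.diff_left)
  have D_adj: "cadjoint D z = 0" for z
  proof -
    have "inner y (abs_operator T (cadjoint D z)) = 0" for y
      by (simp add: D_abs inner_cadjoint[OF D, symmetric]
          positive_operator_selfadjoint[OF positive_abs_operator[OF T], symmetric])
    then have "abs_operator T (cadjoint D z) = 0"
      by (metis inner_eq_zero_iff)
    then have "cadjoint D z \<in> kernel T"
      using norm_abs_operator[OF T, of "cadjoint D z"] by (simp add: kernel_def)
    then have "U (cadjoint D z) = 0" "V (cadjoint D z) = 0"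
      using U(2) V(2) by (auto simp: kernel_def)
    then have "D (cadjoint D z) = 0"
      by (subst D_def) (simp add: blinfun.diff_left)
    then show ?thesis
      using inner_cadjoint[OF D, of "cadjoint D z" z] by simp
  qed
  have "D x = 0" for x
    using inner_cadjoint[OF D, of x "D x"] by (simp add: D_adj)
  then show ?thesis
    by (intro blinfun_eqI) (simp add: D_def blinfun.diff_left)
qed

text \<open>Uniqueness identifies the described operator with the constructed one, so the norm bound
  of the construction carries over.\<close>

lemma
  fixes T :: "'h::chilbert_space \<Rightarrow>\<^sub>L 'h"
  assumes "T \<in> bounded_operators"
  shows partial_isometry_polar_isometry: "partial_isometry (polar_isometry T)"
    and kernel_polar_isometry: "kernel (polar_isometry T) = kernel T"
    and polar_decomposition: "polar_isometry T o\<^sub>L abs_operator T = T"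
    and norm_polar_isometry: "norm (polar_isometry T) \<le> 1"
proof -
  obtain U where U: "partial_isometry U" "kernel U = kernel T" "T = U o\<^sub>L abs_operator T" "norm U \<le> 1"
    using exists_polar_isometry[OF assms] by blast
  have "polar_isometry T = U"
    unfolding polar_isometry_def
  proof (rule the_equality)
    show "partial_isometry U \<and> kernel U = kernel T \<and> T = U o\<^sub>L abs_operator T"
      using U by blast
    show "V = U" if "partial_isometry V \<and> kernel V = kernel T \<and> T = V o\<^sub>L abs_operator T" for V
      using that U assms polar_isometry_unique[of T V U] unfolding partial_isometry_def by blast
  qed
  then show "partial_isometry (polar_isometry T)" "kernel (polar_isometry T) = kernel T"
    "polar_isometry T o\<^sub>L abs_operator T = T" "norm (polar_isometry T) \<le> 1"
    using U by simp_all
qed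

text \<open>With \<open>P = |T|\<close>, the absolute value of \<open>cadjoint T\<close> is
  \<open>U o\<^sub>L (P o\<^sub>L cadjoint U)\<close>. Since \<open>cadjoint U o\<^sub>L U\<close>
  fixes the range of \<open>P\<close>, this operator squares to
  \<open>T o\<^sub>L cadjoint T\<close>, and composing it with \<open>U\<close> leaves
  \<open>U o\<^sub>L P\<close>, which is \<open>T\<close>.\<close>

lemma abs_cadjoint_polar_isometry:
  fixes T :: "'h::chilbert_space \<Rightarrow>\<^sub>L 'h"
  assumes T: "T \<in> bounded_operators"
  shows "abs_operator (cadjoint T) o\<^sub>L polar_isometry T = T"
proof -
  define P U where "P = abs_operator T" and "U = polar_isometry T"
  have P: "positive_operator P"
    using T by (simp add: P_def positive_abs_operator)
  note P_sa = positive_operator_selfadjoint[OF P]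
  have U: "U \<in> bounded_operators"
    using partial_isometry_polar_isometry[OF T] by (simp add: U_def partial_isometry_def)
  note U_adj = inner_cadjoint[OF U]
  have UP: "U (P x) = T x" for x
    using arg_cong[OF polar_decomposition[OF T], of "\<lambda>Z. Z x"] by (simp add: U_def P_def)
  \<comment> \<open>The defect \<open>w\<close> is orthogonal to the range of \<open>P\<close>,
    because \<open>P\<close> and \<open>U o\<^sub>L P\<close> induce the same inner products. Hence
    \<open>P w = 0\<close> and, the kernels being equal, \<open>U w = 0\<close>; so \<open>w\<close>
    is orthogonal to both of its terms.\<close>
  have UUP: "cadjoint U (U (P y)) = P y" for y
  proof -
    define w where "w = cadjoint U (U (P y)) - P y"
    have "inner (P z) w = 0" for z
      using T by (simp add: w_def inner_diff_right U_adj[symmetric] UP) (simp add: P_def inner_abs_operator)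
    then have Pw: "P w = 0"
      using P_sa[of "P w" w] by simp
    then have "w \<in> kernel T"
      using norm_abs_operator[OF T, of w] by (simp add: P_def kernel_def)
    then have "U w = 0"
      using kernel_polar_isometry[OF T] by (auto simp: U_def kernel_def)
    then have "inner w (cadjoint U (U (P y))) = 0" "inner w (P y) = 0"
      using Pw by (simp_all add: U_adj[symmetric] P_sa[symmetric])
    then have "inner w w = 0"
      unfolding w_def by (simp add: inner_diff_right)
    then show ?thesis by (simp add: w_def)
  qed
  \<comment> \<open>The adjoint of the identity \<open>UUP\<close>.\<close>
  have PUU: "P (cadjoint U (U x)) = P x" for x
  proof (rule vector_eq_ldot[THEN iffD1], rule allI)
    fix y
    have "inner y (P (cadjoint U (U x))) = inner (U (P y)) (U x)"
      by (simp add: P_sa[symmetric] U_adj[symmetric])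
    also have "\<dots> = inner (cadjoint U (U (P y))) x"
      by (metis U_adj inner_commute)
    also have "\<dots> = inner y (P x)"
      by (simp add: UUP P_sa)
    finally show "inner y (P (cadjoint U (U x))) = inner y (P x)" .
  qed
  have adj_T: "cadjoint T = P o\<^sub>L cadjoint U"
    using T by (rule cadjoint_eqI) (simp add: UP[symmetric] U_adj P_sa)
  have "abs_operator (cadjoint T) = U o\<^sub>L (P o\<^sub>L cadjoint U)"
  proof (rule abs_operator_eqI)
    have *: "inner ((U o\<^sub>L (P o\<^sub>L cadjoint U)) x) y = inner (P (cadjoint U x)) (cadjoint U y)" for x y
      by (simp add: U_adj)
    show "positive_operator (U o\<^sub>L (P o\<^sub>L cadjoint U))"
    proof (rule positive_operatorI)
      show "U o\<^sub>L (P o\<^sub>L cadjoint U) \<in> bounded_operators"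
        using U positive_operator_bounded[OF P]
        by (intro bounded_operators_compose bounded_operators_cadjoint)
      show "inner ((U o\<^sub>L (P o\<^sub>L cadjoint U)) x) y = inner x ((U o\<^sub>L (P o\<^sub>L cadjoint U)) y)" for x y
        using *[of x y] *[of y x] P_sa[of "cadjoint U x" "cadjoint U y"] by (metis inner_commute)
      show "0 \<le> inner ((U o\<^sub>L (P o\<^sub>L cadjoint U)) x) x" for x
        unfolding * by (rule positive_operator_inner_nonneg[OF P])
    qed
    show "(U o\<^sub>L (P o\<^sub>L cadjoint U)) o\<^sub>L (U o\<^sub>L (P o\<^sub>L cadjoint U)) =
        cadjoint (cadjoint T) o\<^sub>L cadjoint T"
      unfolding cadjoint_cadjoint[OF T] unfolding adj_T
      by (rule blinfun_eqI) (simp add: UUP[unfolded UP] PUU UP)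
  qed
  then show ?thesis
    unfolding U_def[symmetric] by (intro blinfun_eqI) (simp add: PUU UP)
qed

section \<open>The norm bound for the mean transform\<close>

lemma norm_mean_transform_le:
  fixes T :: "'h::chilbert_space \<Rightarrow>\<^sub>L 'h"
  assumes "T \<in> bounded_operators"
  shows "norm (mean_transform l T) \<le> norm (l *\<^sub>R abs_operator (cadjoint T) + (1 - l) *\<^sub>R abs_operator T)"
    (is "_ \<le> norm ?N")
proof -
  have "mean_transform l T = ?N o\<^sub>L polar_isometry T"
  proof (rule blinfun_eqI)
    fix x
    have "T x = abs_operator (cadjoint T) (polar_isometry T x)"
      using arg_cong[OF abs_cadjoint_polar_isometry[OF assms], of "\<lambda>Z. Z x"] by simp
    then show "mean_transform l T x = (?N o\<^sub>L polar_isometry T) x"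
      by (simp add: mean_transform_def duggal_transform_def blinfun.bilinear_simps)
  qed
  then have "norm (mean_transform l T) \<le> norm ?N * norm (polar_isometry T)"
    by (simp add: norm_blinfun_compose)
  also have "\<dots> \<le> norm ?N"
    using norm_polar_isometry[OF assms] by (intro mult_left_le) auto
  finally show ?thesis .
qed

section \<open>Block operators\<close>

text \<open>The form with projections rewrites at any argument, not only at explicit pairs.\<close>

lemma block_operator_apply [simp]:
  "block_operator T11 T12 T21 T22 p = (T11 (fst p) + T12 (snd p), T21 (fst p) + T22 (snd p))"
  by (cases p) (simp add: block_operator.rep_eq)

lemma bounded_operators_antidiagonal:
  assumes "A \<in> bounded_operators" "B \<in> bounded_operators"
  shows "block_operator 0 A B 0 \<in> bounded_operators"
  using assms by (simp add: bounded_operators_def scaleC_prod_def)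

lemma cadjoint_antidiagonal:
  assumes "A \<in> bounded_operators" "B \<in> bounded_operators"
  shows "cadjoint (block_operator 0 A B 0) = block_operator 0 (cadjoint B) (cadjoint A) 0"
  by (rule cadjoint_eqI)
    (simp_all add: assms bounded_operators_antidiagonal inner_prod_def inner_cadjoint)

lemma positive_operator_diagonal:
  assumes "positive_operator P" "positive_operator Q"
  shows "positive_operator (block_operator P 0 0 Q)"
proof (rule positive_operatorI)
  show "block_operator P 0 0 Q \<in> bounded_operators"
    using assms[THEN positive_operator_bounded] by (simp add: bounded_operators_def scaleC_prod_def)
  show "inner (block_operator P 0 0 Q x) y = inner x (block_operator P 0 0 Q y)" for x y
    using assms by (simp add: inner_prod_def positive_operator_selfadjoint)
  show "0 \<le> inner (block_operator P 0 0 Q x) x" for x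
    using assms by (simp add: inner_prod_def positive_operator_inner_nonneg add_nonneg_nonneg
)
qed

text \<open>The product of the adjoint with the operator is block diagonal with entries
  \<open>cadjoint B o\<^sub>L B\<close> and \<open>cadjoint A o\<^sub>L A\<close>; taking roots
  entrywise gives its positive root.\<close>

lemma abs_operator_antidiagonal:
  assumes "A \<in> bounded_operators" "B \<in> bounded_operators"
  shows "abs_operator (block_operator 0 A B 0) = block_operator (abs_operator B) 0 0 (abs_operator A)"
proof (rule abs_operator_eqI)
  show "positive_operator (block_operator (abs_operator B) 0 0 (abs_operator A))"
    using assms by (intro positive_operator_diagonal positive_abs_operator)
  have "abs_operator T (abs_operator T x) = cadjoint T (T x)" if "T \<in> bounded_operators" for T and x :: 'a
    using arg_cong[OF abs_operator_square[OF that], of "\<lambda>Z. Z x"] by simp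
  then show "block_operator (abs_operator B) 0 0 (abs_operator A) o\<^sub>L
      block_operator (abs_operator B) 0 0 (abs_operator A) =
      cadjoint (block_operator 0 A B 0) o\<^sub>L block_operator 0 A B 0"
    using assms by (intro blinfun_eqI) (simp add: cadjoint_antidiagonal)
qed

text \<open>The norm on pairs is Pythagorean, so the bounds on the two components combine with a
  common constant.\<close>

lemma norm_block_diagonal_le:
  fixes P Q :: "'h::chilbert_space \<Rightarrow>\<^sub>L 'h"
  shows "norm (block_operator P 0 0 Q) \<le> max (norm P) (norm Q)"
proof (rule norm_blinfun_bound)
  let ?M = "max (norm P) (norm Q)"
  show "0 \<le> ?M" by (simp add: le_max_iff_disj)
  fix p :: "'h \<times> 'h"
  have P: "norm (P (fst p)) \<le> ?M * norm (fst p)"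
    by (rule order_trans[OF norm_blinfun]) (simp add: mult_right_mono)
  have Q: "norm (Q (snd p)) \<le> ?M * norm (snd p)"
    by (rule order_trans[OF norm_blinfun]) (simp add: mult_right_mono)
  have "norm (block_operator P 0 0 Q p) = sqrt ((norm (P (fst p)))\<^sup>2 + (norm (Q (snd p)))\<^sup>2)"
    by (simp add: norm_prod_def)
  also have "\<dots> \<le> sqrt ((?M * norm (fst p))\<^sup>2 + (?M * norm (snd p))\<^sup>2)"
    using P Q by (intro real_sqrt_le_mono add_mono power_mono) auto
  also have "\<dots> = ?M * norm p"
    using \<open>0 \<le> ?M\<close> by (simp add: norm_prod_def power_mult_distrib real_sqrt_mult flip: distrib_left)
  finally show "norm (block_operator P 0 0 Q p) \<le> ?M * norm p" .
qed

theorem theorem24: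
  fixes A B :: "'h::chilbert_space \<Rightarrow>\<^sub>L 'h" and l :: real
  assumes "A \<in> bounded_operators" and "B \<in> bounded_operators"
    and "l \<in> {0..1}"
  shows "norm (mean_transform l (block_operator 0 A B 0))
    \<le> max (norm (l *\<^sub>R abs_operator (cadjoint A) + (1 - l) *\<^sub>R abs_operator B))
          (norm (l *\<^sub>R abs_operator (cadjoint B) + (1 - l) *\<^sub>R abs_operator A))"
proof -
  let ?S = "block_operator 0 A B 0"
  \<comment> \<open>The adjoint of \<open>?S\<close> is again antidiagonal, with entries
    \<open>cadjoint B\<close> and \<open>cadjoint A\<close>, so its absolute value has diagonal
    entries \<open>abs_operator (cadjoint A)\<close> and
    \<open>abs_operator (cadjoint B)\<close>.\<close>
  have "l *\<^sub>R abs_operator (cadjoint ?S) + (1 - l) *\<^sub>R abs_operator ?S =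
      block_operator (l *\<^sub>R abs_operator (cadjoint A) + (1 - l) *\<^sub>R abs_operator B) 0 0
        (l *\<^sub>R abs_operator (cadjoint B) + (1 - l) *\<^sub>R abs_operator A)"
    using assms
    by (intro blinfun_eqI) (simp add: cadjoint_antidiagonal abs_operator_antidiagonal
        bounded_operators_cadjoint blinfun.bilinear_simps)
  with norm_mean_transform_le[OF bounded_operators_antidiagonal[OF assms(1,2)], of l]
  show ?thesis
    using norm_block_diagonal_le by (auto intro: order_trans)
qed

end
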